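(* Let $p\in[1,2]$ and let $\mu$ be a $p$-exponential measure in a separable Banach space $(X,\|\cdot\|_X)$ with Schauder basis, with concentration function $\varphi_w$. For any $w\in X$, $$-\log\mu(w+\epsilon B_X)\le\varphi_w(\epsilon/2)\qquad\text{for all }\epsilon>0.$$
   Context: Let $p\in[1,2]$, let $\gamma=(\gamma_\ell)_{\ell\in\mathbb{N}}$ be a deterministic decaying sequence of positive reals, and let $\xi_\ell$, $\ell\in\mathbb{N}$, be i.i.d. real random variables with density $f_p(x)\propto\exp(-|x|^p/p)$. The $p$-exponential measure $\mu$ with scaling sequence $\gamma$ is the law of $(\gamma_\ell\xi_\ell)_{\ell\in\mathbb{N}}$ on $\mathbb{R}^\infty$ (real sequences with the product Borel $\sigma$-algebra). If $X$ is a separable Banach space with Schauder basis $\{\psi_\ell\}$ (every $u\in X$ has a unique expansion $u=\sum_\ell u_\ell\psi_\ell$ converging in $\|\cdot\|_X$), a sequence $(u_\ell)$ is identified with $\sum_\ell u_\ell\psi_\ell$; $\mu$ is a $p$-exponential measure in $X$ if, under this identification, $\mu(X)=1$, i.e. $\mu$ is the law of $\sum_\ell\gamma_\ell\xi_\ell\psi_\ell\in X$. Define $\mathcal{Z}=\{h\in\mathbb{R}^\infty:\|h\|_{\mathcal{Z}}^p=\sum_\ell|h_\ell|^p\gamma_\ell^{-p}<\infty\}$, identified with a subspace of $X$. $B_X$ is the closed unit ball of $X$ centered at the origin. For $w\in X$ the concentration function is $$\varphi_w(\epsilon)=\inf_{h\in\mathcal{Z}:\,\|h-w\|_X\le\epsilon}\frac1p\|h\|_{\mathcal{Z}}^p-\log\mu(\epsilon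 B_X),\qquad\epsilon>0.$$ *)

theory Defs
  imports "HOL-Probability.Probability"
begin

definition schauder_basis :: "(nat \<Rightarrow> 'a::real_normed_vector) \<Rightarrow> bool" where
  "schauder_basis \<psi> \<longleftrightarrow> (\<forall>u. \<exists>!c :: nat \<Rightarrow> real. (\<lambda>l. c l *\<^sub>R \<psi> l) sums u)"

definition basis_coords :: "(nat \<Rightarrow> 'a::real_normed_vector) \<Rightarrow> 'a \<Rightarrow> nat \<Rightarrow> real" where
  "basis_coords \<psi> u = (THE c. (\<lambda>l. c l *\<^sub>R \<psi> l) sums u)"

definition p_exp_density :: "real \<Rightarrow> real \<Rightarrow> real" where
  "p_exp_density p x =
     exp (- (\<bar>x\<bar> powr p / p)) / (LINT y|lborel. exp (- (\<bar>y\<bar> powr p / p)))"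

definition p_exp_noise :: "real \<Rightarrow> real measure" where
  "p_exp_noise p = density lborel (\<lambda>x. ennreal (p_exp_density p x))"

text \<open>The law of \<open>(\<gamma>\<^sub>l \<xi>\<^sub>l)\<^sub>l\<close> on real sequences, where the \<open>\<xi>\<^sub>l\<close> are i.i.d. with density
  \<open>p_exp_density p\<close>, i.e. \<open>\<xi>\<close> has the infinite product of \<open>p_exp_noise p\<close> as its law.\<close>

definition p_exp_seq_measure :: "real \<Rightarrow> (nat \<Rightarrow> real) \<Rightarrow> (nat \<Rightarrow> real) measure" where
  "p_exp_seq_measure p \<gamma> =
     distr (\<Pi>\<^sub>M l\<in>UNIV. p_exp_noise p) (\<Pi>\<^sub>M l\<in>UNIV. borel) (\<lambda>\<xi> l. \<gamma> l * \<xi> l)"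

text \<open>The space \<open>X\<close> corresponds to the sequences \<open>u\<close> for which \<open>\<Sum>l. u l *\<^sub>R \<psi> l\<close> converges. The
  first conjunct is \<open>\<mu>(X) = 1\<close>; consequently the value that \<open>suminf\<close> takes on divergent series
  is irrelevant for the push-forward in the second conjunct.\<close>

definition p_exponential_measure_in ::
    "real \<Rightarrow> (nat \<Rightarrow> real) \<Rightarrow> (nat \<Rightarrow> 'a::{banach, second_countable_topology}) \<Rightarrow> 'a measure \<Rightarrow> bool" where
  "p_exponential_measure_in p \<gamma> \<psi> \<mu> \<longleftrightarrow>
     measure (p_exp_seq_measure p \<gamma>) {u. summable (\<lambda>l. u l *\<^sub>R \<psi> l)} = 1 \<and>
     \<mu> = distr (p_exp_seq_measure p \<gamma>) borel (\<lambda>u. \<Sum>l. u l *\<^sub>R \<psi> l)"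

definition Z_space :: "real \<Rightarrow> (nat \<Rightarrow> real) \<Rightarrow> (nat \<Rightarrow> real) set" where
  "Z_space p \<gamma> = {h. summable (\<lambda>l. \<bar>h l\<bar> powr p * \<gamma> l powr (- p))}"

definition Z_norm :: "real \<Rightarrow> (nat \<Rightarrow> real) \<Rightarrow> (nat \<Rightarrow> real) \<Rightarrow> real" where
  "Z_norm p \<gamma> h = (\<Sum>l. \<bar>h l\<bar> powr p * \<gamma> l powr (- p)) powr (1 / p)"

text \<open>Logarithm of a non-negative real with the convention \<open>log 0 = -\<infinity>\<close>.\<close>

definition elog :: "real \<Rightarrow> ereal" where
  "elog x = (if x = 0 then -\<infinity> else ereal (ln x))"

text \<open>The infimum is over the elements of \<open>X\<close> whose coordinate sequence lies in \<open>Z_space\<close>. It is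
  taken in the extended reals, so that the infimum over the empty set is \<open>\<infinity>\<close>.\<close>

definition concentration_function ::
    "real \<Rightarrow> (nat \<Rightarrow> real) \<Rightarrow> (nat \<Rightarrow> 'a::{banach, second_countable_topology}) \<Rightarrow> 'a measure
      \<Rightarrow> 'a \<Rightarrow> real \<Rightarrow> ereal" where
  "concentration_function p \<gamma> \<psi> \<mu> w \<epsilon> =
     (INF h \<in> {h. basis_coords \<psi> h \<in> Z_space p \<gamma> \<and> norm (h - w) \<le> \<epsilon>}.
        ereal (1 / p * Z_norm p \<gamma> (basis_coords \<psi> h) powr p))
     - elog (measure \<mu> (cball 0 \<epsilon>))"

end

theory Submission
  imports Defs
begin

text \<open>Shifting finitely many coordinates of the noise by \<open>\<eta>\<close> changes its law by the density
  \<open>exp (\<Sum>l. (\<bar>x l\<bar>\<^sup>p - \<bar>x l - \<eta> l\<bar>\<^sup>p) / p)\<close>. The probability of a symmetric set \<open>A\<close> after the shift by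
  \<open>\<eta>\<close> equals that after the shift by \<open>-\<eta>\<close>, so the density may be replaced by the average of the two,
  which by AM-GM and Clarkson's inequality \<open>\<bar>u + h\<bar>\<^sup>p + \<bar>u - h\<bar>\<^sup>p \<le> 2 (\<bar>u\<bar>\<^sup>p + \<bar>h\<bar>\<^sup>p)\<close> is at least
  \<open>exp (- (\<Sum>l. \<bar>\<eta> l\<bar>\<^sup>p) / p)\<close>. Hence \<open>\<mu>(h + r B\<^sub>X) \<ge> exp (- \<parallel>h\<parallel>\<^sub>Z\<^sup>p / p) \<mu>(r B\<^sub>X)\<close> for finitely supported \<open>h\<close>;
  approximating \<open>h\<close> in \<open>Z\<close> by its partial sums and using continuity of \<open>\<mu>\<close> along decreasing balls
  gives this for all \<open>h\<close> in \<open>Z\<close>. No equivalence of \<open>\<mu>\<close> and its shift by \<open>h\<close> is needed. For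
  \<open>\<parallel>h - w\<parallel> \<le> \<epsilon>/2\<close> the ball \<open>w + \<epsilon> B\<^sub>X\<close> contains \<open>h + (\<epsilon>/2) B\<^sub>X\<close>.\<close>

section \<open>Concavity of powers and Clarkson's inequality on the real line\<close>

lemma powr_add_le_add_powr:
  fixes a b :: real
  assumes "0 \<le> a" "0 \<le> b" "0 < \<theta>" "\<theta> \<le> 1"
  shows "(a + b) powr \<theta> \<le> a powr \<theta> + b powr \<theta>"
proof (cases "a + b = 0")
  case True
  then show ?thesis using assms by auto
next
  case False
  define m where "m = a + b"
  have m: "m > 0" using False assms unfolding m_def by linarith
  \<comment> \<open>Numbers in [0,1] do not decrease when the exponent drops from 1 to
    \<open>\<theta>\<close>; it is applied to \<open>a / m\<close> and \<open>b / m\<close>, which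
    add up to 1.\<close>
  have *: "x / m \<le> (x / m) powr \<theta>" if "0 \<le> x" "x \<le> m" for x
    using powr_mono'[of \<theta> 1 "x / m"] that m assms by (cases "x = 0") auto
  have "1 = a / m + b / m" using m by (simp add: m_def add_divide_distrib[symmetric])
  also have "\<dots> \<le> (a / m) powr \<theta> + (b / m) powr \<theta>"
    using assms by (intro add_mono *) (auto simp: m_def)
  also have "\<dots> = (a powr \<theta> + b powr \<theta>) / m powr \<theta>"
    using assms m by (simp add: powr_divide add_divide_distrib)
  finally show ?thesis using m by (simp add: field_simps m_def)
qed

text \<open>A concave power lies below its tangent at 1. This is Young's inequality for
  \<open>t\<close> and 1 with weights \<open>\<theta>\<close> and \<open>1 - \<theta>\<close>; the
  case \<open>t = 0\<close> reduces to \<open>\<theta> \<le> 1\<close>.\<close>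

lemma powr_le_tangent:
  fixes t :: real
  assumes "0 \<le> t" "0 < \<theta>" "\<theta> \<le> 1"
  shows "t powr \<theta> \<le> 1 + \<theta> * (t - 1)"
proof (cases "t = 0")
  case False
  then have "t powr \<theta> * 1 powr (1 - \<theta>) \<le> \<theta> * t + (1 - \<theta>) * 1"
    using assms by (intro Youngs_inequality_0) auto
  then show ?thesis by (simp add: algebra_simps)
qed (use assms in auto)

text \<open>With \<open>\<theta> = p / 2\<close>, the p-th power of the modulus is a concave power
  of the square. By the parallelogram law \<open>m\<close> is the mean of the squares of
  \<open>u + h\<close> and \<open>u - h\<close>, so the tangent at \<open>m\<close> bounds both
  terms and the slope contributions cancel, leaving \<open>2 * m powr \<theta>\<close>.
  Subadditivity then splits \<open>m powr \<theta>\<close>.\<close>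

lemma clarkson_inequality_real:
  fixes u h p :: real
  assumes "1 \<le> p" "p \<le> 2"
  shows "\<bar>u + h\<bar> powr p + \<bar>u - h\<bar> powr p \<le> 2 * (\<bar>u\<bar> powr p + \<bar>h\<bar> powr p)"
proof (cases "u = 0 \<and> h = 0")
  case False
  define \<theta> where "\<theta> = p / 2"
  define m where "m = u\<^sup>2 + h\<^sup>2"
  have \<theta>: "0 < \<theta>" "\<theta> \<le> 1" using assms by (auto simp: \<theta>_def)
  have m: "m > 0" using False by (simp add: m_def sum_power2_gt_zero_iff)
  have sq: "\<bar>x\<bar> powr p = (x\<^sup>2) powr \<theta>" for x :: real
  proof -
    have "(x\<^sup>2) powr \<theta> = (\<bar>x\<bar> powr 2) powr \<theta>" by (simp add: powr_numeral)
    then show ?thesis by (simp only: powr_powr) (simp add: \<theta>_def)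
  qed
  have t: "x\<^sup>2 powr \<theta> \<le> m powr \<theta> * (1 + \<theta> * (x\<^sup>2 / m - 1))" for x :: real
  proof -
    have "x\<^sup>2 powr \<theta> = m powr \<theta> * (x\<^sup>2 / m) powr \<theta>"
      using m by (simp add: powr_divide)
    also have "\<dots> \<le> m powr \<theta> * (1 + \<theta> * (x\<^sup>2 / m - 1))"
      using m \<theta> by (intro mult_left_mono powr_le_tangent) auto
    finally show ?thesis .
  qed
  have "(u + h)\<^sup>2 powr \<theta> + (u - h)\<^sup>2 powr \<theta>
      \<le> m powr \<theta> * (1 + \<theta> * ((u + h)\<^sup>2 / m - 1)) + m powr \<theta> * (1 + \<theta> * ((u - h)\<^sup>2 / m - 1))"
    by (intro add_mono t)
  also have "\<dots> = m powr \<theta> * (2 + \<theta> * (((u + h)\<^sup>2 + (u - h)\<^sup>2) / m - 2))"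
    by (simp add: algebra_simps add_divide_distrib)
  also have "(u + h)\<^sup>2 + (u - h)\<^sup>2 = 2 * m"
    by (simp add: m_def power2_eq_square algebra_simps)
  also have "m powr \<theta> * (2 + \<theta> * (2 * m / m - 2)) = 2 * m powr \<theta>" using m by simp
  also have "m powr \<theta> \<le> (u\<^sup>2) powr \<theta> + (h\<^sup>2) powr \<theta>"
    unfolding m_def using \<theta> by (intro powr_add_le_add_powr) auto
  finally show ?thesis by (simp add: sq)
qed auto

section \<open>The one-dimensional noise: normalisation, shifts and reflection\<close>

lemma integrable_exp_powr:
  assumes "1 \<le> p"
  shows "integrable lborel (\<lambda>y::real. exp (- (\<bar>y\<bar> powr p / p)))"
proof -
  let ?e = "exponential_density (1 / p)"
  have p: "0 < p" using assms by simp
  interpret E: prob_space "density lborel ?e"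
    using p by (intro prob_space_exponential_density) simp
  have e: "integrable lborel ?e"
  proof (rule integrableI_nonneg)
    have "(\<integral>\<^sup>+ x. ennreal (?e x) \<partial>lborel) = emeasure (density lborel ?e) UNIV"
      by (subst emeasure_density) auto
    then show "(\<integral>\<^sup>+ x. ennreal (?e x) \<partial>lborel) < \<infinity>"
      using E.emeasure_space_1 by simp
  qed (use p in auto)
  \<comment> \<open>The reflected density covers the negative half-line. In the dominating function,
    \<open>exp (1 / p)\<close> comes from
    \<open>\<bar>x\<bar> \<le> 1 + \<bar>x\<bar> powr p\<close> divided by \<open>p\<close>, and the
    factor \<open>p\<close> removes the normalisation of \<open>?e\<close>.\<close>
  have "integrable lborel (\<lambda>x. ?e (0 + (-1) * x))"
    by (rule lborel_integrable_real_affine[OF e]) simp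
  then have "integrable lborel (\<lambda>x. exp (1 / p) * p * (?e x + ?e (- x)))"
    using e by auto
  then show ?thesis
  proof (rule Bochner_Integration.integrable_bound)
    show "AE x in lborel. norm (exp (- (\<bar>x\<bar> powr p / p)))
        \<le> norm (exp (1 / p) * p * (?e x + ?e (- x)))"
    proof (intro AE_I2)
      fix x :: real
      have "\<bar>x\<bar> \<le> 1 + \<bar>x\<bar> powr p"
      proof (cases "\<bar>x\<bar> \<le> 1")
        case True
        then show ?thesis using powr_ge_zero[of "\<bar>x\<bar>" p] by linarith
      next
        case False
        then show ?thesis using powr_mono[of 1 p "\<bar>x\<bar>"] assms by simp
      qed
      then have "- (\<bar>x\<bar> powr p / p) \<le> 1 / p - \<bar>x\<bar> / p"
        using p by (simp add: field_simps)
      then have "exp (- (\<bar>x\<bar> powr p / p)) \<le> exp (1 / p) * exp (- (\<bar>x\<bar> / p))"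
        by (simp flip: exp_add)
      \<comment> \<open>At \<open>x = 0\<close> both one-sided densities are positive, so this is an
        inequality and not an equation.\<close>
      also have "\<dots> \<le> exp (1 / p) * (p * (?e x + ?e (- x)))"
        using p by (intro mult_left_mono) (auto simp: exponential_density_def)
      finally show "norm (exp (- (\<bar>x\<bar> powr p / p))) \<le> norm (exp (1 / p) * p * (?e x + ?e (- x)))"
        by simp
    qed
  qed simp
qed

lemma p_exp_density_borel [measurable]: "p_exp_density p \<in> borel_measurable borel"
  unfolding p_exp_density_def by measurable

lemma p_exp_density_nonneg: "0 \<le> p_exp_density p x"
  unfolding p_exp_density_def by (intro divide_nonneg_nonneg integral_nonneg_AE) auto

lemma p_exp_density_minus: "p_exp_density p (- x) = p_exp_density p x"
  by (simp add: p_exp_density_def)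

lemma p_exp_density_shift:
  "p_exp_density p (x - t) = p_exp_density p x * exp ((\<bar>x\<bar> powr p - \<bar>x - t\<bar> powr p) / p)"
proof -
  have "exp (- (\<bar>x - t\<bar> powr p / p))
      = exp (- (\<bar>x\<bar> powr p / p)) * exp ((\<bar>x\<bar> powr p - \<bar>x - t\<bar> powr p) / p)"
    by (simp add: diff_divide_distrib flip: exp_add)
  then show ?thesis by (simp add: p_exp_density_def)
qed

lemma prob_space_p_exp_noise:
  assumes "1 \<le> p"
  shows "prob_space (p_exp_noise p)"
proof
  let ?g = "\<lambda>y::real. exp (- (\<bar>y\<bar> powr p / p))"
  let ?c = "LINT y|lborel. ?g y"
  \<comment> \<open>A zero integral would make the quotient in \<open>p_exp_density\<close> equal to
    0. It is excluded because the integrand is positive everywhere and Lebesgue measure is not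
    null.\<close>
  have c: "?c > 0"
  proof -
    have "?c \<noteq> 0"
    proof
      assume "?c = 0"
      then have "AE y in lborel. ?g y = 0"
        by (subst (asm) integral_nonneg_eq_0_iff_AE[OF integrable_exp_powr[OF assms]]) auto
      then have "AE y::real in lborel. False" by simp
      then show False by (simp add: eventually_False ae_filter_eq_bot_iff)
    qed
    moreover have "?c \<ge> 0" by (intro integral_nonneg_AE) auto
    ultimately show ?thesis by linarith
  qed
  have "emeasure (p_exp_noise p) UNIV = (\<integral>\<^sup>+x. ennreal (p_exp_density p x) \<partial>lborel)"
    unfolding p_exp_noise_def by (subst emeasure_density) auto
  also have "\<dots> = ennreal (LINT x|lborel. p_exp_density p x)"
    using integrable_exp_powr[OF assms] p_exp_density_nonneg
    by (intro nn_integral_eq_integral) (auto simp: p_exp_density_def[abs_def])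
  also have "\<dots> = 1" using c by (simp add: p_exp_density_def[abs_def])
  finally show "emeasure (p_exp_noise p) (space (p_exp_noise p)) = 1"
    by (simp add: p_exp_noise_def)
qed

lemma sets_p_exp_noise [simp, measurable_cong]: "sets (p_exp_noise p) = sets borel"
  by (simp add: p_exp_noise_def)

lemma space_p_exp_noise [simp]: "space (p_exp_noise p) = UNIV"
  by (simp add: p_exp_noise_def)

text \<open>Translation invariance of Lebesgue measure moves the shift from \<open>f\<close> to the
  density; the exponential is the likelihood ratio of shifted to unshifted noise.\<close>

lemma nn_integral_p_exp_noise_shift:
  assumes [measurable]: "f \<in> borel_measurable borel"
  shows "(\<integral>\<^sup>+x. f (x + t) \<partial>p_exp_noise p)
    = (\<integral>\<^sup>+x. f x * ennreal (exp ((\<bar>x\<bar> powr p - \<bar>x - t\<bar> powr p) / p)) \<partial>p_exp_noise p)"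
proof -
  have "(\<integral>\<^sup>+x. f (x + t) \<partial>p_exp_noise p) = (\<integral>\<^sup>+x. ennreal (p_exp_density p x) * f (x + t) \<partial>lborel)"
    unfolding p_exp_noise_def by (subst nn_integral_density) auto
  also have "\<dots> = (\<integral>\<^sup>+x. ennreal (p_exp_density p (x - t)) * f x \<partial>lborel)"
    by (subst nn_integral_real_affine[where c = 1 and t = "- t"]) auto
  also have "\<dots> = (\<integral>\<^sup>+x. ennreal (p_exp_density p x)
      * (f x * ennreal (exp ((\<bar>x\<bar> powr p - \<bar>x - t\<bar> powr p) / p))) \<partial>lborel)"
    by (intro nn_integral_cong)
       (simp add: p_exp_density_shift p_exp_density_nonneg ennreal_mult mult_ac)
  also have "\<dots> = (\<integral>\<^sup>+x. f x * ennreal (exp ((\<bar>x\<bar> powr p - \<bar>x - t\<bar> powr p) / p)) \<partial>p_exp_noise p)"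
    unfolding p_exp_noise_def by (subst nn_integral_density) auto
  finally show ?thesis .
qed

lemma distr_p_exp_noise_uminus: "distr (p_exp_noise p) borel uminus = p_exp_noise p"
proof (rule measure_eqI)
  fix A assume "A \<in> sets (distr (p_exp_noise p) borel uminus)"
  then have A[measurable]: "A \<in> sets borel" by simp
  have "emeasure (distr (p_exp_noise p) borel uminus) A = (\<integral>\<^sup>+x. indicator A (- x) \<partial>p_exp_noise p)"
    by (simp add: nn_integral_distr flip: nn_integral_indicator)
  also have "\<dots> = (\<integral>\<^sup>+x. ennreal (p_exp_density p x) * indicator A (- x) \<partial>lborel)"
    unfolding p_exp_noise_def by (subst nn_integral_density) auto
  also have "\<dots> = (\<integral>\<^sup>+x. ennreal (p_exp_density p x) * indicator A x \<partial>lborel)"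
    by (subst nn_integral_real_affine[where c = "-1" and t = 0]) (auto simp: p_exp_density_minus)
  also have "\<dots> = emeasure (p_exp_noise p) A"
    unfolding p_exp_noise_def by (subst emeasure_density) auto
  finally show "emeasure (distr (p_exp_noise p) borel uminus) A = emeasure (p_exp_noise p) A" .
qed simp

section \<open>The product law of the noise: redrawing, shifting and reflecting coordinates\<close>

lemma measurable_PiM_UNIV:
  assumes "\<And>l. (\<lambda>x. f x l) \<in> measurable M (N l)"
  shows "f \<in> measurable M (\<Pi>\<^sub>M l\<in>UNIV. N l)"
  using assms assms[THEN measurable_space] by (intro measurable_PiM_single') auto

text \<open>Coordinate \<open>k\<close> is independent of the others, so redrawing it preserves the
  product law. The inner integral is over one coordinate, where one-dimensional formulas
  apply.\<close>

lemma nn_integral_PiM_resample: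
  fixes N :: "real measure"
  assumes "prob_space N" and N[measurable_cong]: "sets N = sets borel"
    and F: "F \<in> borel_measurable (\<Pi>\<^sub>M (l::nat)\<in>UNIV. N)"
  shows "(\<integral>\<^sup>+x. F x \<partial>(\<Pi>\<^sub>M l\<in>UNIV. N)) = (\<integral>\<^sup>+x. \<integral>\<^sup>+s. F (x(k := s)) \<partial>N \<partial>(\<Pi>\<^sub>M l\<in>UNIV. N))"
proof -
  note F[measurable]
  let ?P = "\<Pi>\<^sub>M (l::nat)\<in>UNIV. N"
  interpret N: prob_space N by fact
  interpret P: prob_space ?P by (intro prob_space_PiM assms)
  interpret PN: pair_sigma_finite N ?P ..
  have [measurable]: "(\<lambda>(s, x). x(k := s)) \<in> measurable (N \<Otimes>\<^sub>M ?P) ?P"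
  proof (rule measurable_PiM_UNIV)
    fix l show "(\<lambda>y. (case y of (s, x) \<Rightarrow> x(k := s)) l) \<in> measurable (N \<Otimes>\<^sub>M ?P) N"
      by (cases "l = k") (auto simp: case_prod_beta)
  qed
  have "?P = distr (N \<Otimes>\<^sub>M ?P) ?P (\<lambda>(s, x). x(k := s))"
    using distr_pair_PiM_eq_PiM[of UNIV "\<lambda>_. N" k] assms(1) by simp
  then have "(\<integral>\<^sup>+x. F x \<partial>?P) = (\<integral>\<^sup>+x. F x \<partial>distr (N \<Otimes>\<^sub>M ?P) ?P (\<lambda>(s, x). x(k := s)))"
    by simp
  also have "\<dots> = (\<integral>\<^sup>+(s, x). F (x(k := s)) \<partial>(N \<Otimes>\<^sub>M ?P))"
    by (subst nn_integral_distr) (auto simp: case_prod_unfold)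
  also have "\<dots> = (\<integral>\<^sup>+x. \<integral>\<^sup>+s. F (x(k := s)) \<partial>N \<partial>?P)"
    by (subst PN.nn_integral_snd[symmetric]) (auto simp: case_prod_beta)
  finally show ?thesis .
qed


text \<open>Induction on \<open>n\<close>: the hypothesis is used for \<open>F\<close> precomposed
  with the shift of coordinate \<open>n\<close>; then that coordinate is redrawn, the
  one-dimensional change of variables is made in it, and the redrawing is undone.\<close>

lemma nn_integral_p_exp_shift:
  fixes \<eta> :: "nat \<Rightarrow> real" and n :: nat
  assumes p: "1 \<le> p" and F: "F \<in> borel_measurable (\<Pi>\<^sub>M (l::nat)\<in>UNIV. p_exp_noise p)"
  shows "(\<integral>\<^sup>+x. F (\<lambda>l. if l < n then x l + \<eta> l else x l) \<partial>(\<Pi>\<^sub>M l\<in>UNIV. p_exp_noise p))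
    = (\<integral>\<^sup>+x. F x * ennreal (exp (\<Sum>l<n. (\<bar>x l\<bar> powr p - \<bar>x l - \<eta> l\<bar> powr p) / p))
        \<partial>(\<Pi>\<^sub>M l\<in>UNIV. p_exp_noise p))"
  using F
proof (induction n arbitrary: F)
  case 0
  then show ?case by simp
next
  case (Suc n)
  note [measurable] = Suc.prems
  let ?N = "p_exp_noise p"
  let ?P = "\<Pi>\<^sub>M (l::nat)\<in>UNIV. ?N"
  let ?G = "\<lambda>x. exp (\<Sum>l<n. (\<bar>x l\<bar> powr p - \<bar>x l - \<eta> l\<bar> powr p) / p)"
  let ?g = "\<lambda>s. exp ((\<bar>s\<bar> powr p - \<bar>s - \<eta> n\<bar> powr p) / p)"
  \<comment> \<open>The sum stops before \<open>n\<close>, so this weight is constant in the redrawn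
    coordinate.\<close>
  have G: "?G (x(n := s)) = ?G x" for x s
    by simp
  have upd[measurable]: "(\<lambda>x. x(n := x n + \<eta> n)) \<in> measurable ?P ?P"
  proof (rule measurable_PiM_UNIV)
    fix l show "(\<lambda>x. (x(n := x n + \<eta> n)) l) \<in> measurable ?P ?N"
      by (cases "l = n") auto
  qed
  have upd'[measurable]: "(\<lambda>s. x(n := s)) \<in> measurable borel ?P" for x
  proof (rule measurable_PiM_UNIV)
    fix l show "(\<lambda>s. (x(n := s)) l) \<in> measurable borel ?N"
      by (cases "l = n") auto
  qed
  have [measurable]: "?G \<in> borel_measurable ?P" by measurable
  have "(\<integral>\<^sup>+x. F (\<lambda>l. if l < Suc n then x l + \<eta> l else x l) \<partial>?P)
      = (\<integral>\<^sup>+x. F ((\<lambda>l. if l < n then x l + \<eta> l else x l)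
            (n := (\<lambda>l. if l < n then x l + \<eta> l else x l) n + \<eta> n)) \<partial>?P)"
    by (intro nn_integral_cong arg_cong[where f = F]) (auto simp: fun_eq_iff less_Suc_eq)
  also have "\<dots> = (\<integral>\<^sup>+x. F (x(n := x n + \<eta> n)) * ennreal (?G x) \<partial>?P)"
    by (rule Suc.IH[where F = "\<lambda>x. F (x(n := x n + \<eta> n))"]) measurable
  also have "\<dots> = (\<integral>\<^sup>+x. \<integral>\<^sup>+s. F (x(n := s + \<eta> n)) * ennreal (?G x) \<partial>?N \<partial>?P)"
    by (subst nn_integral_PiM_resample[where k = n]) (auto simp: prob_space_p_exp_noise[OF p])
  also have "\<dots> = (\<integral>\<^sup>+x. \<integral>\<^sup>+s. F (x(n := s)) * ennreal (?G x) * ennreal (?g s) \<partial>?N \<partial>?P)"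
    by (intro nn_integral_cong nn_integral_p_exp_noise_shift) measurable
  also have "\<dots> = (\<integral>\<^sup>+x. F x * ennreal (?G x) * ennreal (?g (x n)) \<partial>?P)"
    by (subst (2) nn_integral_PiM_resample[where k = n]) (auto simp: prob_space_p_exp_noise[OF p])
  also have "\<dots> = (\<integral>\<^sup>+x. F x * ennreal (exp (\<Sum>l<Suc n. (\<bar>x l\<bar> powr p - \<bar>x l - \<eta> l\<bar> powr p) / p)) \<partial>?P)"
    by (simp add: exp_add ennreal_mult mult.assoc)
  finally show ?case .
qed

text \<open>Both laws agree on cylinder sets, since reflection acts on each coordinate separately
  and the law of each coordinate is symmetric.\<close>

lemma distr_PiM_p_exp_noise_uminus:
  assumes p: "1 \<le> p"
  shows "distr (\<Pi>\<^sub>M (l::nat)\<in>UNIV. p_exp_noise p) (\<Pi>\<^sub>M (l::nat)\<in>UNIV. p_exp_noise p) (\<lambda>x l. - x l)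
    = (\<Pi>\<^sub>M l\<in>UNIV. p_exp_noise p)"
    (is "distr ?P ?P ?m = _")
proof (rule measure_eqI_PiM_infinite[symmetric, OF refl])
  interpret P: prob_space ?P by (intro prob_space_PiM prob_space_p_exp_noise p)
  show "finite_measure ?P" by unfold_locales
  have [measurable]: "?m \<in> measurable ?P ?P"
    by (rule measurable_PiM_UNIV) measurable
  fix A :: "nat \<Rightarrow> real set" and J :: "nat set"
  assume J: "finite J" and A: "\<And>i. i \<in> J \<Longrightarrow> A i \<in> sets (p_exp_noise p)"
  have A': "uminus -` A i \<in> sets (p_exp_noise p)" if "i \<in> J" for i
    using measurable_sets[of "uminus :: real \<Rightarrow> real" borel borel "A i"] A[OF that] by simp
  let ?E = "\<lambda>A. prod_emb UNIV (\<lambda>_. p_exp_noise p) J (Pi\<^sub>E J A)"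
  have "emeasure (distr ?P ?P ?m) (?E A) = emeasure ?P (?m -` ?E A \<inter> space ?P)"
    using J A by (subst emeasure_distr) auto
  also have "?m -` ?E A \<inter> space ?P = ?E (\<lambda>i. uminus -` A i)"
    by (auto simp: prod_emb_def space_PiM PiE_iff)
  also have "emeasure ?P \<dots> = (\<Prod>i\<in>J. emeasure (p_exp_noise p) (uminus -` A i))"
    using J A' prob_space_p_exp_noise[OF p] by (intro emeasure_PiM_emb) auto
  also have "\<dots> = (\<Prod>i\<in>J. emeasure (p_exp_noise p) (A i))"
  proof (intro prod.cong refl)
    fix i assume "i \<in> J"
    then show "emeasure (p_exp_noise p) (uminus -` A i) = emeasure (p_exp_noise p) (A i)"
      using A[of i] distr_p_exp_noise_uminus[of p]
        emeasure_distr[of uminus "p_exp_noise p" borel "A i"] by simp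
  qed
  also have "\<dots> = emeasure ?P (?E A)"
    using J A prob_space_p_exp_noise[OF p] by (intro emeasure_PiM_emb[symmetric]) auto
  finally show "emeasure ?P (?E A) = emeasure (distr ?P ?P ?m) (?E A)" ..
qed simp

section \<open>Lower bound for the probability of a shifted symmetric set\<close>

lemma two_exp_mean_le:
  fixes a b :: real
  shows "2 * exp ((a + b) / 2) \<le> exp a + exp b"
proof -
  have "exp ((a + b) / 2) = exp (a / 2) * exp (b / 2)" "exp a = (exp (a / 2))\<^sup>2" "exp b = (exp (b / 2))\<^sup>2"
    by (simp_all add: add_divide_distrib power2_eq_square flip: exp_add)
  then show ?thesis
    using zero_le_power2[of "exp (a / 2) - exp (b / 2)"] by (simp add: power2_diff)
qed

text \<open>The symmetry of \<open>A\<close> permits averaging the densities of two opposite shifts,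
  and the average has a lower bound free of \<open>x\<close>.\<close>

lemma emeasure_p_exp_shift_ge:
  fixes \<eta> :: "nat \<Rightarrow> real" and n :: nat
  assumes p: "1 \<le> p" "p \<le> 2"
    and A: "A \<in> sets (\<Pi>\<^sub>M (l::nat)\<in>UNIV. p_exp_noise p)"
    and sym: "\<And>x. x \<in> A \<longleftrightarrow> (\<lambda>l. - x l) \<in> A"
  shows "ennreal (exp (- ((\<Sum>l<n. \<bar>\<eta> l\<bar> powr p) / p))) * emeasure (\<Pi>\<^sub>M l\<in>UNIV. p_exp_noise p) A
    \<le> (\<integral>\<^sup>+x. indicator A (\<lambda>l. if l < n then x l + \<eta> l else x l) \<partial>(\<Pi>\<^sub>M l\<in>UNIV. p_exp_noise p))"
proof -
  note [measurable] = A
  let ?P = "\<Pi>\<^sub>M (l::nat)\<in>UNIV. p_exp_noise p"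
  let ?c = "exp (- ((\<Sum>l<n. \<bar>\<eta> l\<bar> powr p) / p))"
  let ?S = "\<lambda>t x. \<Sum>l<n. (\<bar>x l\<bar> powr p - \<bar>x l - t * \<eta> l\<bar> powr p) / p"
  \<comment> \<open>\<open>t\<close> is used only at 1 and -1, so that both shifts share one density
    formula.\<close>
  define I where "I t = (\<integral>\<^sup>+x. indicator A (\<lambda>l. if l < n then x l + t * \<eta> l else x l) \<partial>?P)"
    for t :: real
  have shift: "I t = (\<integral>\<^sup>+x. indicator A x * ennreal (exp (?S t x)) \<partial>?P)" for t
    unfolding I_def by (rule nn_integral_p_exp_shift[OF p(1)]) measurable
  have [measurable]: "(\<lambda>x l. - x l) \<in> measurable ?P ?P"
    by (rule measurable_PiM_UNIV) measurable
  have [measurable]: "(\<lambda>x l. if l < n then x l + t * \<eta> l else x l) \<in> measurable ?P ?P" for t :: real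
    by (rule measurable_PiM_UNIV) measurable
  \<comment> \<open>Reflecting the noise keeps its law; pulling the sign through the symmetric set
    \<open>A\<close> turns the shift by \<open>\<eta>\<close> into the shift by
    \<open>- \<eta>\<close>.\<close>
  have "I 1 = I (- 1)"
  proof -
    have "I 1 = (\<integral>\<^sup>+x. indicator A (\<lambda>l. if l < n then x l + 1 * \<eta> l else x l) \<partial>distr ?P ?P (\<lambda>x l. - x l))"
      unfolding I_def distr_PiM_p_exp_noise_uminus[OF p(1)] ..
    also have "\<dots> = (\<integral>\<^sup>+x. indicator A (\<lambda>l. if l < n then - x l + 1 * \<eta> l else - x l) \<partial>?P)"
      by (subst nn_integral_distr) auto
    also have "\<dots> = I (- 1)"
      unfolding I_def
    proof (intro nn_integral_cong)
      fix x :: "nat \<Rightarrow> real"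
      have "(\<lambda>l. - (if l < n then - x l + 1 * \<eta> l else - x l)) = (\<lambda>l. if l < n then x l + - 1 * \<eta> l else x l)"
        by (auto simp: fun_eq_iff)
      then show "(indicator A (\<lambda>l. if l < n then - x l + 1 * \<eta> l else - x l) :: ennreal)
          = indicator A (\<lambda>l. if l < n then x l + - 1 * \<eta> l else x l)"
        using sym[of "\<lambda>l. if l < n then - x l + 1 * \<eta> l else - x l"] by (simp add: indicator_def)
    qed
    finally show ?thesis .
  qed
  \<comment> \<open>Clarkson's inequality in each coordinate bounds the mean of the two exponents
    from below; AM-GM passes from there to the mean of the two densities.\<close>
  have pointwise: "2 * ?c \<le> exp (?S 1 x) + exp (?S (- 1) x)" for x
  proof -
    have "- (\<Sum>l<n. \<bar>\<eta> l\<bar> powr p / p) \<le> (?S 1 x + ?S (- 1) x) / 2"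
      unfolding sum.distrib[symmetric] sum_negf[symmetric] sum_divide_distrib
    proof (intro sum_mono)
      fix l
      have "(- (2 * \<bar>\<eta> l\<bar> powr p)) / p
          \<le> (2 * \<bar>x l\<bar> powr p - (\<bar>x l + \<eta> l\<bar> powr p + \<bar>x l - \<eta> l\<bar> powr p)) / p"
        using clarkson_inequality_real[OF p, of "x l" "\<eta> l"] p by (intro divide_right_mono) auto
      then show "- (\<bar>\<eta> l\<bar> powr p / p) \<le> ((\<bar>x l\<bar> powr p - \<bar>x l - 1 * \<eta> l\<bar> powr p) / p
          + (\<bar>x l\<bar> powr p - \<bar>x l - - 1 * \<eta> l\<bar> powr p) / p) / 2"
        by (simp add: diff_divide_distrib add_divide_distrib)
    qed
    then have "2 * ?c \<le> 2 * exp ((?S 1 x + ?S (- 1) x) / 2)"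
      by (simp add: sum_divide_distrib)
    also have "\<dots> \<le> exp (?S 1 x) + exp (?S (- 1) x)" by (rule two_exp_mean_le)
    finally show ?thesis .
  qed
  have "2 * (ennreal ?c * emeasure ?P A) = (\<integral>\<^sup>+x. indicator A x * ennreal (2 * ?c) \<partial>?P)"
    by (subst nn_integral_multc) (auto simp: ennreal_mult mult_ac)
  also have "\<dots> \<le> (\<integral>\<^sup>+x. indicator A x * ennreal (exp (?S 1 x) + exp (?S (- 1) x)) \<partial>?P)"
    using pointwise by (intro nn_integral_mono mult_left_mono ennreal_leI) auto
  also have "\<dots> = (\<integral>\<^sup>+x. indicator A x * ennreal (exp (?S 1 x)) + indicator A x * ennreal (exp (?S (- 1) x)) \<partial>?P)"
    by (simp add: distrib_left)
  also have "\<dots> = I 1 + I (- 1)"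
    unfolding shift by (rule nn_integral_add) measurable
  also have "\<dots> = 2 * I 1" using \<open>I 1 = I (- 1)\<close> by (simp add: mult_2)
  finally have "ennreal ?c * emeasure ?P A \<le> I 1"
    by (subst (asm) ennreal_mult_le_mult_iff) auto
  then show ?thesis by (simp add: I_def cong: if_cong)
qed

section \<open>Transfer between noise sequences and the Banach space\<close>

lemma measure_eq_1_imp_AE_mem:
  assumes "prob_space M" "measure M A = 1"
  shows "A \<in> sets M" "AE x in M. x \<in> A"
proof -
  interpret prob_space M by fact
  \<comment> \<open>\<open>measure\<close> is 0 on non-measurable sets, so the value 1 already
    forces measurability.\<close>
  show "A \<in> sets M" using assms(2) measure_notin_sets[of A M] by force
  show "AE x in M. x \<in> A" using assms(2) by (rule AE_prob_1)
qed

lemma measurable_scale_noise: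
  "(\<lambda>\<xi> l. \<gamma> l * \<xi> l) \<in> measurable (\<Pi>\<^sub>M (l::nat)\<in>UNIV. p_exp_noise p) (\<Pi>\<^sub>M l\<in>UNIV. borel)"
  by (rule measurable_PiM_UNIV) measurable

text \<open>This moves all probabilities to the noise space \<open>P\<close>. The events there
  include convergence of the series, so the arbitrary value of \<open>suminf\<close> on divergent
  series never enters.\<close>

lemma p_exponential_measure_in_props:
  fixes \<psi> :: "nat \<Rightarrow> 'a::{banach, second_countable_topology}"
  assumes p: "1 \<le> p" and \<mu>: "p_exponential_measure_in p \<gamma> \<psi> \<mu>"
  defines "P \<equiv> \<Pi>\<^sub>M (l::nat)\<in>UNIV. p_exp_noise p"
  shows "prob_space \<mu>" "sets \<mu> = sets borel"
    and "{\<xi>. summable (\<lambda>l. (\<gamma> l * \<xi> l) *\<^sub>R \<psi> l)} \<in> sets P"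
    and "(\<lambda>\<xi>. \<Sum>l. (\<gamma> l * \<xi> l) *\<^sub>R \<psi> l) \<in> borel_measurable P"
    and "B \<in> sets borel \<Longrightarrow> emeasure \<mu> B
      = emeasure P {\<xi>. summable (\<lambda>l. (\<gamma> l * \<xi> l) *\<^sub>R \<psi> l) \<and> (\<Sum>l. (\<gamma> l * \<xi> l) *\<^sub>R \<psi> l) \<in> B}"
proof -
  let ?Q = "p_exp_seq_measure p \<gamma>"
  let ?s = "\<lambda>\<xi> l. \<gamma> l * \<xi> l"
  let ?C = "{u. summable (\<lambda>l. u l *\<^sub>R \<psi> l)}"
  let ?S = "\<lambda>u. \<Sum>l. u l *\<^sub>R \<psi> l"
  interpret P: prob_space P
    unfolding P_def by (intro prob_space_PiM prob_space_p_exp_noise p)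
  have scale[measurable]: "?s \<in> measurable P (\<Pi>\<^sub>M l\<in>UNIV. borel)"
    unfolding P_def by (rule measurable_scale_noise)
  have Q: "?Q = distr P (\<Pi>\<^sub>M l\<in>UNIV. borel) ?s"
    by (simp add: p_exp_seq_measure_def P_def)
  interpret Q: prob_space ?Q unfolding Q by (rule P.prob_space_distr) measurable
  have S: "?S \<in> borel_measurable (\<Pi>\<^sub>M l\<in>UNIV. borel)" by measurable
  have S': "?S \<in> borel_measurable ?Q" unfolding Q using S by simp
  have \<mu>_eq: "\<mu> = distr ?Q borel ?S" and C1: "measure ?Q ?C = 1"
    using \<mu> unfolding p_exponential_measure_in_def by auto
  note C = measure_eq_1_imp_AE_mem[OF Q.prob_space_axioms C1]
  have C_sets[measurable]: "?C \<in> sets (\<Pi>\<^sub>M l\<in>UNIV. borel)" using C(1) by (simp add: Q)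
  show "prob_space \<mu>" unfolding \<mu>_eq by (rule Q.prob_space_distr[OF S'])
  show "sets \<mu> = sets borel" unfolding \<mu>_eq by simp
  have pre: "?s -` ?C \<inter> space P = {\<xi>. summable (\<lambda>l. (\<gamma> l * \<xi> l) *\<^sub>R \<psi> l)}"
    by (auto simp: P_def space_PiM)
  show sum_sets: "{\<xi>. summable (\<lambda>l. (\<gamma> l * \<xi> l) *\<^sub>R \<psi> l)} \<in> sets P"
    using measurable_sets[OF scale C_sets] unfolding pre .
  show S_P: "(\<lambda>\<xi>. \<Sum>l. (\<gamma> l * \<xi> l) *\<^sub>R \<psi> l) \<in> borel_measurable P"
    using measurable_comp[OF scale S] by (simp add: comp_def)
  have AE_P: "AE \<xi> in P. summable (\<lambda>l. (\<gamma> l * \<xi> l) *\<^sub>R \<psi> l)"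
    using AE_distrD[OF scale C(2)[unfolded Q]] by simp
  show "emeasure \<mu> B
      = emeasure P {\<xi>. summable (\<lambda>l. (\<gamma> l * \<xi> l) *\<^sub>R \<psi> l) \<and> (\<Sum>l. (\<gamma> l * \<xi> l) *\<^sub>R \<psi> l) \<in> B}"
    if B[measurable]: "B \<in> sets borel"
  proof -
    have space: "space P = UNIV" by (simp add: P_def space_PiM)
    have "\<mu> = distr P borel (\<lambda>\<xi>. \<Sum>l. (\<gamma> l * \<xi> l) *\<^sub>R \<psi> l)"
      unfolding \<mu>_eq Q by (subst distr_distr[OF S scale]) (simp add: comp_def)
    then have "emeasure \<mu> B = emeasure P ((\<lambda>\<xi>. \<Sum>l. (\<gamma> l * \<xi> l) *\<^sub>R \<psi> l) -` B \<inter> space P)"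
      using S_P by (simp add: emeasure_distr)
    \<comment> \<open>The series converges almost surely, so intersecting with the convergence event
      changes no probability.\<close>
    also have "\<dots> = emeasure P ({\<xi>. summable (\<lambda>l. (\<gamma> l * \<xi> l) *\<^sub>R \<psi> l)}
        \<inter> ((\<lambda>\<xi>. \<Sum>l. (\<gamma> l * \<xi> l) *\<^sub>R \<psi> l) -` B \<inter> space P))"
      using AE_P sum_sets measurable_sets[OF S_P B]
      by (intro emeasure_eq_AE) auto
    finally show ?thesis by (simp add: space Int_def)
  qed
qed

text \<open>Shifting the first \<open>n\<close> noise coordinates translates the random series by a
  finite sum, and landing in a ball around 0 is a symmetric event. Division by
  \<open>\<gamma>\<close> in \<open>\<eta>\<close> produces the weights of the Z-norm.\<close>

lemma emeasure_cball_partial_sum_ge: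
  fixes \<psi> :: "nat \<Rightarrow> 'a::{banach, second_countable_topology}"
  assumes p: "1 \<le> p" "p \<le> 2" and \<gamma>: "\<And>l. \<gamma> l > 0"
    and \<mu>: "p_exponential_measure_in p \<gamma> \<psi> \<mu>"
  shows "ennreal (exp (- ((\<Sum>l<n. \<bar>c l\<bar> powr p * \<gamma> l powr (- p)) / p))) * emeasure \<mu> (cball 0 r)
    \<le> emeasure \<mu> (cball (\<Sum>l<n. c l *\<^sub>R \<psi> l) r)"
proof -
  let ?P = "\<Pi>\<^sub>M (l::nat)\<in>UNIV. p_exp_noise p"
  let ?f = "\<lambda>\<xi> l. (\<gamma> l * \<xi> l) *\<^sub>R \<psi> l"
  let ?H = "\<Sum>l<n. c l *\<^sub>R \<psi> l"
  \<comment> \<open>With the minus sign the shift subtracts \<open>?H\<close> from the series: the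
    shifted series hits the ball around 0 exactly when the original one hits the ball around
    \<open>?H\<close>.\<close>
  define \<eta> where "\<eta> l = - (c l / \<gamma> l)" for l
  define B where "B w = {\<xi>. summable (?f \<xi>) \<and> suminf (?f \<xi>) \<in> cball w r}" for w
  note props = p_exponential_measure_in_props[OF p(1) \<mu>]
  have space: "space ?P = UNIV" by (simp add: space_PiM)
  have B: "B w \<in> sets ?P" for w
  proof -
    have "B w = {\<xi>. summable (?f \<xi>)} \<inter> ((\<lambda>\<xi>. suminf (?f \<xi>)) -` cball w r \<inter> space ?P)"
      by (auto simp: B_def space)
    also have "\<dots> \<in> sets ?P"
      using props(3) measurable_sets[OF props(4), of "cball w r"] by auto
    finally show ?thesis .
  qed
  have \<mu>B: "emeasure \<mu> (cball w r) = emeasure ?P (B w)" for w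
    unfolding B_def by (rule props(5)) simp
  have "(\<lambda>l. - x l) \<in> B 0" if "x \<in> B 0" for x
    using that by (auto simp: B_def summable_minus_iff suminf_minus dest: suminf_minus)
  from this this[of "\<lambda>l. - x l" for x] have sym: "x \<in> B 0 \<longleftrightarrow> (\<lambda>l. - x l) \<in> B 0" for x
    by auto
  have shift: "indicator (B 0) (\<lambda>l. if l < n then x l + \<eta> l else x l) = (indicator (B ?H) x :: ennreal)"
    for x
  proof -
    let ?x = "\<lambda>l. if l < n then x l + \<eta> l else x l"
    \<comment> \<open>Written as a series vanishing from index \<open>n\<close> on,
      \<open>?H\<close> can be added or subtracted termwise without affecting convergence.\<close>
    let ?d = "\<lambda>l. if l \<in> {..<n} then c l *\<^sub>R \<psi> l else 0"
    have d: "?d sums ?H" by (rule sums_If_finite_set) simp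
    have eq: "?f ?x = (\<lambda>l. ?f x l - ?d l)"
      using \<gamma>[THEN less_imp_neq]
      by (auto simp: fun_eq_iff \<eta>_def distrib_left right_diff_distrib scaleR_diff_left)
    have eq': "?f x = (\<lambda>l. ?f ?x l + ?d l)"
      using fun_cong[OF eq] by (intro ext) (metis diff_add_cancel)
    have sum: "summable (?f ?x) \<longleftrightarrow> summable (?f x)"
    proof
      assume "summable (?f ?x)"
      then show "summable (?f x)" by (subst eq') (intro summable_add sums_summable[OF d])
    next
      assume "summable (?f x)"
      then show "summable (?f ?x)" by (subst eq) (intro summable_diff sums_summable[OF d])
    qed
    have "suminf (?f ?x) = suminf (?f x) - ?H" if "summable (?f x)"
      unfolding eq using suminf_diff[OF that sums_summable[OF d]] sums_unique[OF d] by simp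
    then have "?x \<in> B 0 \<longleftrightarrow> x \<in> B ?H"
      unfolding B_def mem_Collect_eq sum by (auto simp: dist_norm norm_minus_commute)
    then show ?thesis by (simp add: indicator_def)
  qed
  have \<eta>: "\<bar>\<eta> l\<bar> powr p = \<bar>c l\<bar> powr p * \<gamma> l powr (- p)" for l
    using \<gamma>[of l] by (simp add: \<eta>_def abs_divide powr_divide powr_minus_divide)
  have "ennreal (exp (- ((\<Sum>l<n. \<bar>\<eta> l\<bar> powr p) / p))) * emeasure ?P (B 0)
      \<le> (\<integral>\<^sup>+x. indicator (B 0) (\<lambda>l. if l < n then x l + \<eta> l else x l) \<partial>?P)"
    by (rule emeasure_p_exp_shift_ge[OF p B sym])
  also have "\<dots> = emeasure ?P (B ?H)" unfolding shift using B by simp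
  finally show ?thesis by (simp only: \<eta> \<mu>B)
qed

section \<open>Balls centred at elements of Z\<close>

lemma cball_subset_cball_add:
  fixes x y :: "'a::metric_space"
  assumes "dist x y \<le> d"
  shows "cball x r \<subseteq> cball y (r + d)"
proof
  fix z assume "z \<in> cball x r"
  then show "z \<in> cball y (r + d)"
    using assms dist_triangle[of y z x] by (simp add: dist_commute)
qed

text \<open>Partial sums have no larger Z-norm than \<open>c\<close> and converge to
  \<open>h\<close> in X, so the ball around a late one lies in a slightly enlarged ball around
  \<open>h\<close>. The enlargement is then sent to 0.\<close>

lemma measure_cball_Z_space_ge:
  fixes \<psi> :: "nat \<Rightarrow> 'a::{banach, second_countable_topology}"
  assumes p: "1 \<le> p" "p \<le> 2" and \<gamma>: "\<And>l. \<gamma> l > 0"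
    and \<mu>: "p_exponential_measure_in p \<gamma> \<psi> \<mu>"
    and c: "c \<in> Z_space p \<gamma>" and h: "(\<lambda>l. c l *\<^sub>R \<psi> l) sums h"
  shows "exp (- (1 / p * Z_norm p \<gamma> c powr p)) * measure \<mu> (cball 0 r) \<le> measure \<mu> (cball h r)"
proof -
  note props = p_exponential_measure_in_props[OF p(1) \<mu>]
  interpret prob_space \<mu> by (rule props(1))
  let ?E = "exp (- (1 / p * Z_norm p \<gamma> c powr p))"
  let ?z = "\<lambda>l. \<bar>c l\<bar> powr p * \<gamma> l powr (- p)"
  have z: "summable ?z" using c by (simp add: Z_space_def)
  have Z: "Z_norm p \<gamma> c powr p = suminf ?z"
    using p suminf_nonneg[OF z] by (simp add: Z_norm_def powr_powr)
  have partial: "?E * measure \<mu> (cball 0 r) \<le> measure \<mu> (cball (\<Sum>l<n. c l *\<^sub>R \<psi> l) r)" for n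
  proof -
    have "(\<Sum>l<n. ?z l) \<le> suminf ?z" using z by (intro sum_le_suminf) auto
    then have "?E \<le> exp (- ((\<Sum>l<n. ?z l) / p))"
      using p unfolding Z by (simp add: divide_right_mono)
    then have "?E * measure \<mu> (cball 0 r) \<le> exp (- ((\<Sum>l<n. ?z l) / p)) * measure \<mu> (cball 0 r)"
      by (intro mult_right_mono) auto
    also have "\<dots> \<le> measure \<mu> (cball (\<Sum>l<n. c l *\<^sub>R \<psi> l) r)"
      using emeasure_cball_partial_sum_ge[OF p \<gamma> \<mu>, where c = c and n = n and r = r]
      by (simp add: emeasure_eq_measure flip: ennreal_mult)
    finally show ?thesis .
  qed
  have enlarged: "?E * measure \<mu> (cball 0 r) \<le> measure \<mu> (cball h (r + \<delta>))" if \<delta>: "\<delta> > 0" for \<delta>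
  proof -
    have "eventually (\<lambda>n. dist (\<Sum>l<n. c l *\<^sub>R \<psi> l) h < \<delta>) sequentially"
      using h \<delta> unfolding sums_def by (rule tendstoD)
    then obtain n where n: "dist (\<Sum>l<n. c l *\<^sub>R \<psi> l) h < \<delta>"
      by (auto dest: eventually_happens)
    have "cball (\<Sum>l<n. c l *\<^sub>R \<psi> l) r \<subseteq> cball h (r + \<delta>)"
      using n by (intro cball_subset_cball_add) simp
    then have "measure \<mu> (cball (\<Sum>l<n. c l *\<^sub>R \<psi> l) r) \<le> measure \<mu> (cball h (r + \<delta>))"
      by (intro finite_measure_mono) (auto simp: props(2))
    with partial[of n] show ?thesis by linarith
  qed
  \<comment> \<open>A closed ball is the intersection of its enlargements, so continuity from above
    applies.\<close>
  have inter: "(\<Inter>k. cball h (r + 1 / real (Suc k))) = cball h r"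
  proof (intro subset_antisym subsetI)
    fix x assume x: "x \<in> (\<Inter>k. cball h (r + 1 / real (Suc k)))"
    have "(\<lambda>k. r + 1 / real (Suc k)) \<longlonglongrightarrow> r + 0"
      by (intro tendsto_intros LIMSEQ_inverse_real_of_nat[unfolded inverse_eq_divide])
    then have "dist h x \<le> r + 0"
      by (rule LIMSEQ_le_const) (use x in auto)
    then show "x \<in> cball h r" by simp
  next
    fix x assume "x \<in> cball h r"
    then have "x \<in> cball h (r + 1 / real (Suc k))" for k
      by (simp add: add_increasing2)
    then show "x \<in> (\<Inter>k. cball h (r + 1 / real (Suc k)))" by blast
  qed
  have "(\<lambda>k. measure \<mu> (cball h (r + 1 / real (Suc k)))) \<longlonglongrightarrow> measure \<mu> (cball h r)"
    unfolding inter[symmetric]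
  proof (rule finite_Lim_measure_decseq)
    show "decseq (\<lambda>k. cball h (r + 1 / real (Suc k)))"
      by (intro decseq_SucI subset_cball add_left_mono divide_left_mono) auto
  qed (auto simp: props(2))
  then show ?thesis
    by (rule LIMSEQ_le_const) (use enlarged in auto)
qed

section \<open>From ball measures to the concentration function\<close>

lemma basis_coords_sums:
  assumes "schauder_basis \<psi>"
  shows "(\<lambda>l. basis_coords \<psi> u l *\<^sub>R \<psi> l) sums u"
  using assms theI'[of "\<lambda>c. (\<lambda>l. c l *\<^sub>R \<psi> l) sums u"]
  unfolding basis_coords_def schauder_basis_def by blast

theorem theorem2p13:
  fixes p :: real
    and \<gamma> :: "nat \<Rightarrow> real"
    and \<psi> :: "nat \<Rightarrow> 'a::{banach, second_countable_topology}"
    and \<mu> :: "'a measure"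
    and w :: 'a
  assumes "1 \<le> p" and "p \<le> 2"
    and "\<And>l. \<gamma> l > 0" and "\<gamma> \<longlonglongrightarrow> 0"
    and "schauder_basis \<psi>"
    and "p_exponential_measure_in p \<gamma> \<psi> \<mu>"
  shows "\<forall>\<epsilon>>0. - elog (measure \<mu> (cball w \<epsilon>)) \<le> concentration_function p \<gamma> \<psi> \<mu> w (\<epsilon> / 2)"
proof (intro allI impI)
  fix \<epsilon> :: real
  assume "\<epsilon> > 0"
  note props = p_exponential_measure_in_props[OF assms(1) assms(6)]
  interpret prob_space \<mu> by (rule props(1))
  let ?J = "\<lambda>h. 1 / p * Z_norm p \<gamma> (basis_coords \<psi> h) powr p"
  let ?H = "{h. basis_coords \<psi> h \<in> Z_space p \<gamma> \<and> norm (h - w) \<le> \<epsilon> / 2}"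
  let ?m = "measure \<mu> (cball 0 (\<epsilon> / 2))"
  let ?M = "measure \<mu> (cball w \<epsilon>)"
  show "- elog ?M \<le> concentration_function p \<gamma> \<psi> \<mu> w (\<epsilon> / 2)"
  proof (cases "?m = 0")
    case True
    \<comment> \<open>Here \<open>elog ?m\<close> is -\<infinity> and the infimum is nonnegative, so
      the right-hand side is \<infinity>.\<close>
    have "0 \<le> (INF h\<in>?H. ereal (?J h))"
      using assms(1) by (intro INF_greatest) auto
    with True show ?thesis
      unfolding concentration_function_def elog_def by auto
  next
    case False
    then have m: "?m > 0" using measure_nonneg[of \<mu> "cball 0 (\<epsilon> / 2)"] by linarith
    \<comment> \<open>\<open>ln ?m\<close> is finite and can be moved to the left, which leaves one
      bound for each \<open>h\<close>; for empty \<open>?H\<close> the infimum is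
      \<infinity>.\<close>
    have "- elog ?M + ereal (ln ?m) \<le> (INF h\<in>?H. ereal (?J h))"
    proof (rule INF_greatest)
      fix h assume h: "h \<in> ?H"
      have "exp (- ?J h) * ?m \<le> measure \<mu> (cball h (\<epsilon> / 2))"
        using h by (intro measure_cball_Z_space_ge[OF assms(1,2,3,6)] basis_coords_sums[OF assms(5)]) auto
      also have "\<dots> \<le> ?M"
      proof (intro finite_measure_mono)
        show "cball h (\<epsilon> / 2) \<subseteq> cball w \<epsilon>"
          using h cball_subset_cball_add[of h w "\<epsilon> / 2" "\<epsilon> / 2"] by (simp add: dist_norm)
      qed (simp add: props(2))
      finally have le: "exp (- ?J h) * ?m \<le> ?M" .
      moreover have pos: "0 < exp (- ?J h) * ?m" using m by simp
      ultimately have "ln (exp (- ?J h) * ?m) \<le> ln ?M" by (subst ln_le_cancel_iff) auto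
      then have "- ?J h + ln ?m \<le> ln ?M" using m by (simp add: ln_mult)
      \<comment> \<open>\<open>le\<close> and \<open>pos\<close> make \<open>?M\<close> positive, so
        \<open>elog ?M\<close> is the finite logarithm.\<close>
      with le pos show "- elog ?M + ereal (ln ?m) \<le> ereal (?J h)"
        by (simp add: elog_def)
    qed
    then show ?thesis
      using False unfolding concentration_function_def elog_def
      by (simp add: ereal_le_minus)
  qed
qed

end
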